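(* Let $X$ be a normed space, and let $\mathcal{C}$ and $\mathcal{K}$ be co-radiant subsets of $X$ such that $d_{\mathcal{C}}\, d_{\mathcal{K}} > 0$ and $\mathcal{K}$ admits a norm base. Consider the following assertions: (i) The pair $(\mathrm{cone}(\mathcal{C}), \mathrm{cone}(\mathcal{K}))$ satisfies the SSP. (ii) There exist $\alpha_1, \alpha_2 \in \mathbb{R}$ with $0 < \alpha_1 < \alpha_2$, and $f \in S_{X^*}$ such that: (a) $\lambda := \inf\{ f(y) - \alpha \| y \| : y \in \mathcal{C},\ \alpha \in (\alpha_1, \alpha_2) \} > 0$; (b) for every $0 < \eta < \frac{\lambda}{I_{\mathcal{K}}}$, the inequalities $$f(y') - \alpha \| y' \| < \lambda < f(y) - \alpha \| y \|$$ hold for all $\alpha \in (\alpha_1, \alpha_2)$, $y' \in \mathrm{bd}(\mathcal{K}(\eta))$, and $y \in \overline{\mathrm{co}}(\mathcal{C})$. Then (i) $\Rightarrow$ (ii). Moreover, if $\mathcal{C}$ also admits a norm base, then (ii) $\Rightarrow$ (i).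
   Context: $X$ is a real normed space with zero $0_X$, dual $X^*$ with dual norm $\|\cdot\|_*$, unit sphere $S_X=\{x:\|x\|=1\}$, and $S_{X^*}=\{f\in X^*:\|f\|_*=1\}$. For $S\subset X$, $\overline S$, $\mathrm{bd}(S)$, $\mathrm{int}(S)$, $\mathrm{co}(S)$, $\overline{\mathrm{co}}(S)$ denote the closure, boundary, interior, convex hull, and closure of the convex hull. Cone: a set $C\subset X$ with $\lambda x\in C$ for all $\lambda\ge 0$, $x\in C$. For $S\subset X$, $\mathrm{cone}(S)=\{\lambda s:\lambda\ge0,\ s\in S\}$. Co-radiant set: a set $\mathcal{C}\subset X$ with $\lambda x\in\mathcal{C}$ for all $\lambda\ge1$, $x\in\mathcal{C}$; all co-radiant sets are assumed proper, i.e. $\mathcal{C}\neq\emptyset$ and $\mathcal{C}\ne X$. For $\varepsilon>0$, $\mathcal{C}(\varepsilon):=\varepsilon\,\mathcal{C}$. $d_{\mathcal{C}}:=\inf\{\|c\|:c\in\mathcal{C}\}\ge 0$. Norm base: for $t>0$ put $\mathcal{C}_t:=\mathcal{C}\cap tS_X$. $\mathcal{C}_t$ is a norm base of $\mathcal{C}$ (with radius $t$) if for every $y\in\mathcal{C}$ there exist $\lambda>0$ and $y_t\in\mathcal{C}_t$ with $y=\lambda y_t$. $\mathcal{C}$ admits a norm base if $\mathcal{C}_t$ is a norm base of $\mathcal{C}$ for some $t>0$; in that case $I_{\mathcal{C}}:=\inf\{t>0:\mathcal{C}_t\text{ is a norm base of }\mathcal{C}\}$. SSP (strict separation property): a pair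 of cones $(C,K)$ in $X$ satisfies the SSP if $0_X\notin\overline{\mathrm{co}(C\cap S_X)-\mathrm{co}\big((\mathrm{bd}(K)\cap S_X)\cup\{0_X\}\big)}$. *)

theory Defs
  imports "HOL-Analysis.Analysis"
begin

definition cone_gen :: "'a::real_vector set \<Rightarrow> 'a set" where
  "cone_gen S = {c *\<^sub>R s | c s. c \<ge> 0 \<and> s \<in> S}"

lemma cone_gen_eq_hull: "cone_gen S = cone hull S"
  by (simp add: cone_gen_def cone_hull_expl)

text \<open>Co-radiant sets are taken to be proper: neither empty nor the whole space.\<close>

definition co_radiant :: "'a::real_vector set \<Rightarrow> bool" where
  "co_radiant C \<longleftrightarrow> C \<noteq> {} \<and> C \<noteq> UNIV \<and> (\<forall>x\<in>C. \<forall>c\<ge>1. c *\<^sub>R x \<in> C)"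

definition scaled :: "'a::real_vector set \<Rightarrow> real \<Rightarrow> 'a set" where
  "scaled C e = (\<lambda>x. e *\<^sub>R x) ` C"

definition dist_zero :: "'a::real_normed_vector set \<Rightarrow> real" where
  "dist_zero C = (INF c\<in>C. norm c)"

definition norm_base :: "'a::real_normed_vector set \<Rightarrow> real \<Rightarrow> bool" where
  "norm_base C t \<longleftrightarrow>
     (\<forall>y\<in>C. \<exists>c>0. \<exists>z \<in> C \<inter> sphere 0 t. y = c *\<^sub>R z)"

definition admits_norm_base :: "'a::real_normed_vector set \<Rightarrow> bool" where
  "admits_norm_base C \<longleftrightarrow> (\<exists>t>0. norm_base C t)"

text \<open>Only meaningful for sets that admit a norm base.\<close>

definition inf_radius :: "'a::real_normed_vector set \<Rightarrow> real" where
  "inf_radius C = Inf {t. t > 0 \<and> norm_base C t}"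

text \<open>Strict separation property; meant for cones \<open>C\<close> and \<open>K\<close>.\<close>

definition ssp :: "'a::real_normed_vector set \<Rightarrow> 'a set \<Rightarrow> bool" where
  "ssp C K \<longleftrightarrow>
     0 \<notin> closure {x - y | x y. x \<in> convex hull (C \<inter> sphere 0 1) \<and>
                              y \<in> convex hull ((frontier K \<inter> sphere 0 1) \<union> {0})}"

definition margin_values ::
    "'a::real_normed_vector set \<Rightarrow> ('a \<Rightarrow>\<^sub>L real) \<Rightarrow> real \<Rightarrow> real \<Rightarrow> real set" where
  "margin_values C f a1 a2 = {f y - a * norm y | y a. y \<in> C \<and> a \<in> {a1<..<a2}}"

text \<open>On \<^typ>\<open>real\<close>, \<^const>\<open>Inf\<close> is unspecified for sets that are not bounded below.
  The conjunct \<^const>\<open>bdd_below\<close> excludes that case, where the infimum in the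
  extended reals is minus infinity and hence not positive.\<close>

definition conically_separated :: "'a::real_normed_vector set \<Rightarrow> 'a set \<Rightarrow> bool" where
  "conically_separated C K \<longleftrightarrow>
     (\<exists>a1 a2. \<exists>f :: 'a \<Rightarrow>\<^sub>L real. 0 < a1 \<and> a1 < a2 \<and> norm f = 1 \<and>
        (let l = Inf (margin_values C f a1 a2) in
           bdd_below (margin_values C f a1 a2) \<and> l > 0 \<and>
           (\<forall>\<eta>. 0 < \<eta> \<and> \<eta> < l / inf_radius K \<longrightarrow>
              (\<forall>a \<in> {a1<..<a2}. \<forall>y' \<in> frontier (scaled K \<eta>). \<forall>y \<in> closure (convex hull C).
                 f y' - a * norm y' < l \<and> l < f y - a * norm y))))"

end

theory Submission
  imports Defs
begin

text \<open>The strict separation property says that the convex set \<open>A - B\<close>, with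
  \<open>A = co(cone(C) \<inter> S)\<close> and \<open>B = co((bd(cone(K)) \<inter> S) \<union> {0})\<close>, stays away from \<open>0\<close>, so by
  Hahn-Banach there is a norm-one \<open>f\<close> with \<open>f \<le> \<beta>\<close> on \<open>B\<close> and \<open>f \<ge> \<beta> + \<delta>\<close> on \<open>A\<close>; both
  \<open>\<alpha>\<close>s are taken strictly between \<open>\<beta>\<close> and \<open>\<beta> + \<delta>\<close>. A boundary point of \<open>K\<close> either lies on
  the boundary of \<open>cone(K)\<close>, where \<open>f - \<alpha>\<parallel>\<cdot>\<parallel> \<le> 0\<close>, or has norm at most \<open>I\<^sub>K\<close>, since \<open>K\<close>
  and \<open>cone(K)\<close> agree outside a ball whose radius is that of a norm base. Conversely, for a unit
  vector \<open>u\<close> in \<open>bd(cone(K))\<close> the whole ray \<open>{c u | c > t}\<close> lies in \<open>bd(K)\<close>, and letting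
  \<open>c\<close> tend to infinity in the upper inequality gives \<open>f u \<le> \<alpha>\<^sub>1\<close>, whereas \<open>f \<ge> \<alpha>\<^sub>2\<close>
  on \<open>A\<close>.\<close>

section \<open>Sublinear functionals and the Hahn-Banach theorem\<close>

definition sublinear :: "('a::real_vector \<Rightarrow> real) \<Rightarrow> bool" where
  "sublinear p \<longleftrightarrow> (\<forall>x y. p (x + y) \<le> p x + p y) \<and> (\<forall>c\<ge>0. \<forall>x. p (c *\<^sub>R x) = c * p x)"

text \<open>One inequality for positive scalars suffices: applied to \<open>inverse c\<close> and
  \<open>c *\<^sub>R x\<close>, it yields the reverse one.\<close>

lemma sublinearI:
  assumes "\<And>x y. p (x + y) \<le> p x + p y"
    and "\<And>c x. c > 0 \<Longrightarrow> p (c *\<^sub>R x) \<le> c * p x"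
    and "p 0 = 0"
  shows "sublinear p"
proof -
  have "p (c *\<^sub>R x) = c * p x" if "c \<ge> 0" for c x
  proof (cases "c = 0")
    case False
    then have "c > 0" using that by simp
    have "p (inverse c *\<^sub>R (c *\<^sub>R x)) \<le> inverse c * p (c *\<^sub>R x)"
      using \<open>c > 0\<close> by (intro assms) simp
    then have "c * p x \<le> p (c *\<^sub>R x)"
      using \<open>c > 0\<close> by (simp add: field_simps)
    then show ?thesis using assms(2)[OF \<open>c > 0\<close>, of x] by simp
  qed (simp add: assms)
  then show ?thesis using assms(1) by (simp add: sublinear_def)
qed

lemma sublinear_add: "sublinear p \<Longrightarrow> p (x + y) \<le> p x + p y"
  by (simp add: sublinear_def)

lemma sublinear_scale: "sublinear p \<Longrightarrow> c \<ge> 0 \<Longrightarrow> p (c *\<^sub>R x) = c * p x"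
  by (simp add: sublinear_def)

lemma sublinear_zero: "sublinear p \<Longrightarrow> p 0 = 0"
  using sublinear_scale[of p 0 0] by simp

lemma sublinear_minus: "sublinear p \<Longrightarrow> - p (- x) \<le> p x"
  using sublinear_add[of p x "- x"] sublinear_zero[of p] by simp

lemma sublinear_norm: "sublinear norm"
  by (rule sublinearI) (auto simp: norm_triangle_ineq)

text \<open>A pair \<open>(z, r)\<close> in \<open>T\<close> encodes the constraint that a linear
  functional be at least \<open>r\<close> at \<open>z\<close>. Lowering \<open>p\<close> to the
  infimum of \<open>p (x + z) - r\<close> over \<open>T\<close> builds all constraints into
  \<open>q\<close>: a linear minorant of \<open>q\<close> satisfies each of them. That
  \<open>T\<close> is a convex cone keeps \<open>q\<close> sublinear.\<close>

lemma sublinear_minorant_cone: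
  fixes p :: "'a::real_vector \<Rightarrow> real" and T :: "('a \<times> real) set"
  assumes p: "sublinear p"
    and T: "convex T" "cone T" "T \<noteq> {}"
    and le: "\<And>z r. (z, r) \<in> T \<Longrightarrow> r \<le> p z"
  obtains q where "sublinear q" "q \<le> p" "\<And>z r. (z, r) \<in> T \<Longrightarrow> q (- z) \<le> - r"
proof -
  define S where "S x = (\<lambda>(z, r). p (x + z) - r) ` T" for x
  define q where "q x = Inf (S x)" for x
  \<comment> \<open>The trivial constraint, which later gives \<open>q \<le> p\<close> and
    \<open>q 0 \<le> 0\<close>.\<close>
  have T0: "(0, 0) \<in> T"
    using T mem_cone[of T _ 0] by (auto simp: zero_prod_def[symmetric])
  have Tadd: "(z + z', r + r') \<in> T" if "(z, r) \<in> T" "(z', r') \<in> T" for z z' r r'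
    using T(1,2) that convex_cone by (metis add_Pair)
  have Tscale: "(c *\<^sub>R z, c * r) \<in> T" if "(z, r) \<in> T" "c \<ge> 0" for c z r
    using mem_cone[OF T(2) that] by (simp add: scaleR_prod_def)
  \<comment> \<open>Compatibility of the constraints with \<open>p\<close> keeps the infimum
    finite.\<close>
  have lower: "- p (- x) \<le> s" if "s \<in> S x" for s x
  proof -
    obtain z r where zr: "(z, r) \<in> T" "s = p (x + z) - r" using \<open>s \<in> S x\<close> by (auto simp: S_def)
    have "p z \<le> p (x + z) + p (- x)" using sublinear_add[OF p, of "x + z" "- x"] by simp
    then show ?thesis using le[OF zr(1)] zr(2) by simp
  qed
  have q_le: "q x \<le> p (x + z) - r" if "(z, r) \<in> T" for x z r
    unfolding q_def using that by (intro cInf_lower bdd_belowI[of _ "- p (- x)"] lower) (auto simp: S_def)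
  have q_ge: "b \<le> q x" if "\<And>z r. (z, r) \<in> T \<Longrightarrow> b \<le> p (x + z) - r" for b x
    unfolding q_def using that T(3) by (intro cInf_greatest) (auto simp: S_def)
  have "sublinear q"
  proof (rule sublinearI)
    fix x y
    have "q (x + y) - q x \<le> p (y + z') - r'" if "(z', r') \<in> T" for z' r'
    proof -
      have "q (x + y) - (p (y + z') - r') \<le> p (x + z) - r" if "(z, r) \<in> T" for z r
        using q_le[OF Tadd[OF that \<open>(z', r') \<in> T\<close>], of "x + y"]
          sublinear_add[OF p, of "x + z" "y + z'"] by (simp add: algebra_simps)
      then have "q (x + y) - (p (y + z') - r') \<le> q x" by (rule q_ge)
      then show ?thesis by simp
    qed
    then have "q (x + y) - q x \<le> q y" by (rule q_ge)
    then show "q (x + y) \<le> q x + q y" by simp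
  next
    fix c :: real and x
    assume "c > 0"
    have "q (c *\<^sub>R x) / c \<le> p (x + z) - r" if "(z, r) \<in> T" for z r
    proof -
      have "q (c *\<^sub>R x) \<le> p (c *\<^sub>R (x + z)) - c * r"
        using q_le[OF Tscale[OF that, of c], of "c *\<^sub>R x"] \<open>c > 0\<close> by (simp add: scaleR_add_right)
      also have "\<dots> = (p (x + z) - r) * c"
        using sublinear_scale[OF p, of c "x + z"] \<open>c > 0\<close> by (simp add: algebra_simps)
      finally show ?thesis using \<open>c > 0\<close> by (simp add: pos_divide_le_eq)
    qed
    then have "q (c *\<^sub>R x) / c \<le> q x" by (rule q_ge)
    then show "q (c *\<^sub>R x) \<le> c * q x" using \<open>c > 0\<close> by (simp add: field_simps)
  next
    show "q 0 = 0"
    proof (rule antisym)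
      show "q 0 \<le> 0" using q_le[OF T0, of 0] sublinear_zero[OF p] by simp
      show "0 \<le> q 0" by (rule q_ge) (simp add: le)
    qed
  qed
  moreover have "q \<le> p" using q_le[OF T0] by (auto simp: le_fun_def)
  moreover have "q (- z) \<le> - r" if "(z, r) \<in> T" for z r
    using q_le[OF that, of "- z"] sublinear_zero[OF p] by simp
  ultimately show thesis using that by blast
qed

text \<open>By Zorn's lemma there is a minimal sublinear functional below \<open>p\<close>; minimality forces
  it to be odd, and an odd sublinear functional is linear.\<close>

lemma hahn_banach_sublinear:
  fixes p :: "'a::real_vector \<Rightarrow> real"
  assumes p: "sublinear p"
  obtains f where "linear f" "f \<le> p"
proof -
  define A where "A = {q. sublinear q \<and> q \<le> p}"
  \<comment> \<open>The order is reversed, so that a maximal element in Zorn's lemma is a minimal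
    functional.\<close>
  define P where "P = (\<lambda>f g :: 'a \<Rightarrow> real. g \<le> f)"
  have po: "partial_order_on A (relation_of P A)"
    by (rule partial_order_on_relation_ofI) (auto simp: P_def)
  have "\<exists>u\<in>A. \<forall>a\<in>Ch. P a u" if "Ch \<in> Chains (relation_of P A)" for Ch
  proof (cases "Ch = {}")
    case True
    then show ?thesis using p by (auto simp: A_def)
  next
    case False
    have chain: "g \<in> A" "g \<le> h \<or> h \<le> g" if "g \<in> Ch" "h \<in> Ch" for g h
      using that \<open>Ch \<in> _\<close> by (auto simp: Chains_def relation_of_def P_def)
    have sub: "sublinear g" "g x \<le> p x" if "g \<in> Ch" for g x
      using chain(1)[OF that that] by (auto simp: A_def le_fun_def)
    \<comment> \<open>The pointwise infimum bounds the chain; it is finite because every member lies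
      above \<open>- p (- x)\<close> at \<open>x\<close>.\<close>
    define q where "q x = (INF g\<in>Ch. g x)" for x
    have q_le: "q x \<le> g x" if "g \<in> Ch" for g x
    proof -
      have "- p (- x) \<le> h x" if "h \<in> Ch" for h
        using sublinear_minus[OF sub(1)[OF that], of x] sub(2)[OF that, of "- x"] by simp
      then show ?thesis unfolding q_def
        using \<open>g \<in> Ch\<close> by (intro cINF_lower bdd_belowI[of _ "- p (- x)"]) auto
    qed
    have q_ge: "b \<le> q x" if "\<And>g. g \<in> Ch \<Longrightarrow> b \<le> g x" for b x
      unfolding q_def using that False by (intro cINF_greatest)
    have "sublinear q"
    proof (rule sublinearI)
      fix x y
      have "q (x + y) - q x \<le> h y" if "h \<in> Ch" for h
      proof -
        have "q (x + y) - h y \<le> g x" if "g \<in> Ch" for g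
        proof -
          \<comment> \<open>Subadditivity survives the infimum because two members of a chain have a
            common lower bound in it.\<close>
          obtain m where m: "m \<in> Ch" "m \<le> g" "m \<le> h"
            using chain(2)[OF \<open>g \<in> Ch\<close> \<open>h \<in> Ch\<close>] \<open>g \<in> Ch\<close> \<open>h \<in> Ch\<close> by blast
          have "q (x + y) \<le> m x + m y"
            using q_le[OF m(1), of "x + y"] sublinear_add[OF sub(1)[OF m(1)], of x y] by simp
          moreover have "m x \<le> g x" "m y \<le> h y" using m by (auto simp: le_fun_def)
          ultimately show ?thesis by simp
        qed
        then have "q (x + y) - h y \<le> q x" by (rule q_ge)
        then show ?thesis by simp
      qed
      then have "q (x + y) - q x \<le> q y" by (rule q_ge)
      then show "q (x + y) \<le> q x + q y" by simp
    next
      fix c :: real and x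
      assume "c > 0"
      have "q (c *\<^sub>R x) / c \<le> g x" if "g \<in> Ch" for g
        using q_le[OF that, of "c *\<^sub>R x"] sublinear_scale[OF sub(1)[OF that], of c x] \<open>c > 0\<close>
        by (simp add: field_simps)
      then have "q (c *\<^sub>R x) / c \<le> q x" by (rule q_ge)
      then show "q (c *\<^sub>R x) \<le> c * q x" using \<open>c > 0\<close> by (simp add: field_simps)
    next
      show "q 0 = 0"
        using False INF_cong[of Ch Ch "\<lambda>g. g 0" "\<lambda>g. 0"] sublinear_zero[OF sub(1)]
        by (simp add: q_def)
    qed
    moreover have "q \<le> p"
      using False q_le sub(2) by (fastforce simp: le_fun_def intro: order_trans)
    ultimately show ?thesis using q_le by (auto simp: A_def P_def le_fun_def)
  qed
  from predicate_Zorn[OF po this] obtain m where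
    m: "sublinear m" "m \<le> p" and min: "\<And>q. sublinear q \<Longrightarrow> q \<le> p \<Longrightarrow> q \<le> m \<Longrightarrow> q = m"
    unfolding A_def P_def by blast
  have odd: "m (- y) = - m y" for y
  proof -
    \<comment> \<open>Along this ray the constraint asks for a value of at least \<open>m y\<close>
      at \<open>y\<close>. The lowered functional must equal \<open>m\<close> by minimality, which
      forces \<open>m (- y) \<le> - m y\<close>.\<close>
    define T where "T = {(c *\<^sub>R y, c * m y) | c. c \<ge> 0}"
    have "T = cone hull {(y, m y)}" by (auto simp: T_def cone_hull_expl)
    then have "convex T" "cone T" "T \<noteq> {}"
      by (simp_all add: convex_cone_hull cone_cone_hull cone_hull_empty_iff[symmetric])
    moreover have "r \<le> m z" if "(z, r) \<in> T" for z r
      using that sublinear_scale[OF m(1)] by (auto simp: T_def)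
    ultimately obtain q where q: "sublinear q" "q \<le> m" "\<And>z r. (z, r) \<in> T \<Longrightarrow> q (- z) \<le> - r"
      using sublinear_minorant_cone[OF m(1)] by metis
    have "(y, m y) \<in> T" unfolding T_def by (rule CollectI, rule exI[of _ 1]) simp
    moreover have "q = m" using min q m(2) order_trans by blast
    ultimately have "m (- y) \<le> - m y" using q(3) by blast
    then show ?thesis using sublinear_minus[OF m(1), of y] by simp
  qed
  have "linear m"
  proof (rule linearI)
    fix x y c
    have "m (- x + - y) \<le> m (- x) + m (- y)" by (rule sublinear_add[OF m(1)])
    then have "m x + m y \<le> m (x + y)" using odd[of "x + y"] odd[of x] odd[of y] by simp
    then show "m (x + y) = m x + m y" using sublinear_add[OF m(1), of x y] by simp
    show "m (c *\<^sub>R x) = c *\<^sub>R m x"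
      using sublinear_scale[OF m(1), of c x] sublinear_scale[OF m(1), of "- c" x] odd[of "c *\<^sub>R x"]
      by (cases "c \<ge> 0") auto
  qed
  then show thesis using that m(2) by blast
qed

text \<open>\<open>D\<close> keeps a distance \<open>r\<close> from the origin, so the constraints
  of value at least \<open>r\<close> on \<open>D\<close> are compatible with the norm. A linear
  minorant of the lowered norm is bounded and at least \<open>r\<close> on \<open>D\<close>;
  normalising it gives \<open>f\<close>.\<close>

lemma strict_separation_zero_convex:
  fixes D :: "'a::real_normed_vector set"
  assumes "convex D" "D \<noteq> {}" "0 \<notin> closure D"
  obtains f :: "'a \<Rightarrow>\<^sub>L real" and \<delta> where "norm f = 1" "\<delta> > 0" "\<And>x. x \<in> D \<Longrightarrow> \<delta> \<le> f x"
proof -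
  obtain r where r: "r > 0" "\<And>x. x \<in> D \<Longrightarrow> r \<le> norm x"
    using assms(3) by (force simp: closure_approachable not_less)
  define T where "T = cone hull (D \<times> {r})"
  have "convex T" "cone T" "T \<noteq> {}" unfolding T_def
    using assms by (auto simp: cone_cone_hull cone_hull_empty_iff[symmetric] intro!: convex_cone_hull convex_Times)
  moreover have "s \<le> norm z" if "(z, s) \<in> T" for z s
    using that r(2) by (auto simp: T_def cone_hull_expl intro!: mult_left_mono)
  ultimately obtain q where q: "sublinear q" "q \<le> norm" "\<And>z s. (z, s) \<in> T \<Longrightarrow> q (- z) \<le> - s"
    using sublinear_minorant_cone[OF sublinear_norm] by metis
  obtain g where g: "linear g" "g \<le> q" using hahn_banach_sublinear[OF q(1)] by blast
  have g_le: "g x \<le> norm x" for x using g(2) q(2) by (meson le_fun_def order_trans)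
  have "norm (g x) \<le> norm x * 1" for x
    using g_le[of x] g_le[of "- x"] linear_neg[OF g(1), of x] by (simp add: abs_le_iff)
  then have bl: "bounded_linear g"
    using g(1) by (intro bounded_linear_intro[where K = 1]) (auto simp: linear_add linear_scale)
  define F where "F = Blinfun g"
  have F: "blinfun_apply F = g" unfolding F_def by (rule bounded_linear_Blinfun_apply[OF bl])
  have ge: "r \<le> g x" if "x \<in> D" for x
  proof -
    have "(x, r) \<in> T" unfolding T_def by (rule hull_inc) (use that in auto)
    then have "g (- x) \<le> - r" using q(3) g(2) by (meson le_fun_def order_trans)
    then show ?thesis using linear_neg[OF g(1)] by simp
  qed
  obtain d where "d \<in> D" using assms(2) by blast
  then have "F \<noteq> 0" using ge[of d] r(1) F by (metis blinfun.zero_left not_le)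
  show thesis
  proof
    show "norm (F /\<^sub>R norm F) = 1" using \<open>F \<noteq> 0\<close> by simp
    show "r / norm F > 0" using r(1) \<open>F \<noteq> 0\<close> by simp
    show "r / norm F \<le> (F /\<^sub>R norm F) x" if "x \<in> D" for x
      using ge[OF that] by (simp add: blinfun.scaleR_left F divide_inverse mult.commute mult_right_mono)
  qed
qed

section \<open>Cones and norm bases\<close>

lemma frontier_scaled:
  fixes K :: "'a::real_normed_vector set"
  assumes "c > 0"
  shows "frontier (scaled K c) = scaled (frontier K) c"
proof -
  have inj: "inj ((*\<^sub>R) c :: 'a \<Rightarrow> 'a)" using assms by (simp add: inj_on_def)
  have "surj ((*\<^sub>R) c :: 'a \<Rightarrow> 'a)"
    using assms by (intro surjI[of _ "(*\<^sub>R) (inverse c)"]) simp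
  then have "bij ((*\<^sub>R) c :: 'a \<Rightarrow> 'a)" using inj by (simp add: bij_def)
  then show ?thesis
    using inj by (simp add: scaled_def frontier_closures image_Int closure_scaleR bij_image_Compl_eq)
qed

lemma scaled_cone_gen:
  assumes "c > 0"
  shows "scaled (cone_gen S) c = cone_gen S"
proof
  show "scaled (cone_gen S) c \<subseteq> cone_gen S"
    using assms by (force simp: scaled_def cone_gen_def)
  show "cone_gen S \<subseteq> scaled (cone_gen S) c"
  proof
    fix x assume "x \<in> cone_gen S"
    then obtain d s where "x = d *\<^sub>R s" "d \<ge> 0" "s \<in> S" by (auto simp: cone_gen_def)
    then have "x = c *\<^sub>R ((d / c) *\<^sub>R s)" "(d / c) *\<^sub>R s \<in> cone_gen S"
      using assms by (simp, force simp: cone_gen_def)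
    then show "x \<in> scaled (cone_gen S) c" unfolding scaled_def by (rule image_eqI)
  qed
qed

lemma frontier_cone_gen_scaleR:
  fixes S :: "'a::real_normed_vector set"
  assumes "c > 0" "x \<in> frontier (cone_gen S)"
  shows "c *\<^sub>R x \<in> frontier (cone_gen S)"
  using frontier_scaled[OF assms(1), of "cone_gen S"] scaled_cone_gen[OF assms(1), of S] assms(2)
  by (auto simp: scaled_def)

lemma cone_gen_superset: "S \<subseteq> cone_gen S"
  by (simp add: cone_gen_eq_hull hull_subset)

lemma cone_gen_scaleR: "x \<in> S \<Longrightarrow> c \<ge> 0 \<Longrightarrow> c *\<^sub>R x \<in> cone_gen S"
  by (auto simp: cone_gen_def)

lemma dist_zero_le: "x \<in> C \<Longrightarrow> dist_zero C \<le> norm x"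
  unfolding dist_zero_def by (rule cINF_lower) (auto intro: bdd_belowI[of _ 0])

lemma dist_zero_nonneg: "C \<noteq> {} \<Longrightarrow> 0 \<le> dist_zero C"
  unfolding dist_zero_def by (rule cINF_greatest) auto

text \<open>A point of the cone is a multiple of a base point of norm \<open>t\<close>; norm at
  least \<open>t\<close> makes the factor at least 1, and co-radiance applies.\<close>

lemma norm_base_cone_gen_mem:
  assumes K: "co_radiant K" and t: "norm_base K t" "t > 0"
    and z: "z \<in> cone_gen K" "norm z \<ge> t"
  shows "z \<in> K"
proof -
  obtain c s where cs: "z = c *\<^sub>R s" "c \<ge> 0" "s \<in> K" using z(1) by (auto simp: cone_gen_def)
  obtain c' k where k: "s = c' *\<^sub>R k" "c' > 0" "k \<in> K" "norm k = t"
    using t(1) cs(3) by (fastforce simp: norm_base_def)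
  have "1 \<le> c * c'" using cs k z(2) t(2) by simp
  then show ?thesis using K k cs(1) by (auto simp: co_radiant_def)
qed

text \<open>Being a frontier point is a local property, and on the open set of vectors of norm above
  \<open>t\<close> the two sets coincide.\<close>

lemma frontier_norm_base_iff:
  fixes K :: "'a::real_normed_vector set"
  assumes K: "co_radiant K" and t: "norm_base K t" "t > 0" and w: "norm w > t"
  shows "w \<in> frontier K \<longleftrightarrow> w \<in> frontier (cone_gen K)"
proof -
  let ?U = "{z :: 'a. t < norm z}"
  have U: "open ?U" by (intro open_Collect_less continuous_intros)
  have sub: "?U \<inter> cone_gen K \<subseteq> K" using norm_base_cone_gen_mem[OF K t] by auto
  have "?U \<inter> interior (cone_gen K) \<subseteq> interior K"
    using sub interior_subset U by (intro interior_maximal) (auto intro: open_Int)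
  moreover have "?U \<inter> closure (cone_gen K) \<subseteq> closure K"
    using open_Int_closure_subset[OF U] closure_mono[OF sub] by blast
  moreover have "interior K \<subseteq> interior (cone_gen K)" "closure K \<subseteq> closure (cone_gen K)"
    by (simp_all add: interior_mono closure_mono cone_gen_superset)
  ultimately show ?thesis using w by (auto simp: frontier_def)
qed

text \<open>A norm base of radius below \<open>norm w\<close> would make the two frontiers agree at
  \<open>w\<close>.\<close>

lemma norm_le_inf_radius:
  assumes K: "co_radiant K" "admits_norm_base K"
    and w: "w \<in> frontier K" "w \<notin> frontier (cone_gen K)"
  shows "norm w \<le> inf_radius K"
  unfolding inf_radius_def
proof (rule cInf_greatest)
  show "{t. t > 0 \<and> norm_base K t} \<noteq> {}" using K(2) by (auto simp: admits_norm_base_def)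
  show "norm w \<le> t" if "t \<in> {t. t > 0 \<and> norm_base K t}" for t
    using frontier_norm_base_iff[OF K(1), of t w] w that by force
qed

text \<open>Every radius of a norm base is the norm of a point of \<open>K\<close>. With
  \<open>dist_zero K > 0\<close> this makes the divisor \<open>inf_radius K\<close>
  positive.\<close>

lemma dist_zero_le_inf_radius:
  assumes "K \<noteq> {}" "admits_norm_base K"
  shows "dist_zero K \<le> inf_radius K"
  unfolding inf_radius_def
proof (rule cInf_greatest)
  show "{t. t > 0 \<and> norm_base K t} \<noteq> {}" using assms(2) by (auto simp: admits_norm_base_def)
  fix t assume "t \<in> {t. t > 0 \<and> norm_base K t}"
  then obtain z where "z \<in> K" "norm z = t" using assms(1) by (fastforce simp: norm_base_def)
  then show "dist_zero K \<le> t" using dist_zero_le by blast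
qed

section \<open>Conical separation\<close>

text \<open>Continuity in \<open>a\<close> carries the bound from the open interval to its right
  endpoint, where it is strongest.\<close>

lemma Inf_margin_values_le:
  assumes bdd: "bdd_below (margin_values C f a1 a2)" and "a1 < a2" and y: "y \<in> C"
  shows "Inf (margin_values C f a1 a2) \<le> f y - a2 * norm y"
proof -
  let ?G = "{a. Inf (margin_values C f a1 a2) \<le> f y - a * norm y}"
  have "closed ?G" by (intro closed_Collect_le continuous_intros)
  moreover have "{a1<..<a2} \<subseteq> ?G"
    using y bdd by (fastforce simp: margin_values_def intro!: cInf_lower)
  ultimately have "closure {a1<..<a2} \<subseteq> ?G" by (rule closure_minimal[rotated])
  moreover have "a2 \<in> closure {a1<..<a2}" using \<open>a1 < a2\<close> by simp
  ultimately show ?thesis by blast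
qed

text \<open>The function \<open>f y - a * norm y\<close> is continuous and concave, so bounds on
  \<open>C\<close> pass to its closed convex hull. The case \<open>a = 0\<close> gives
  half-spaces.\<close>

lemma closed_convex_superlevel:
  fixes f :: "'a::real_normed_vector \<Rightarrow>\<^sub>L real"
  assumes "a \<ge> 0"
  shows "closed {y. l \<le> f y - a * norm y}" "convex {y. l \<le> f y - a * norm y}"
proof -
  show "closed {y. l \<le> f y - a * norm y}" by (intro closed_Collect_le continuous_intros)
  show "convex {y. l \<le> f y - a * norm y}"
  proof (rule convexI, rule CollectI)
    fix x y u v
    assume xy: "x \<in> {y. l \<le> f y - a * norm y}" "y \<in> {y. l \<le> f y - a * norm y}"
      and uv: "0 \<le> u" "0 \<le> v" "u + v = (1::real)"
    have "l = u * l + v * l" using uv(3) by (metis distrib_right mult_1)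
    also have "\<dots> \<le> u * (f x - a * norm x) + v * (f y - a * norm y)"
      using xy uv by (intro add_mono mult_left_mono) auto
    also have "\<dots> = f (u *\<^sub>R x + v *\<^sub>R y) - a * (u * norm x + v * norm y)"
      by (simp add: blinfun.add_right blinfun.scaleR_right algebra_simps)
    also have "\<dots> \<le> f (u *\<^sub>R x + v *\<^sub>R y) - a * norm (u *\<^sub>R x + v *\<^sub>R y)"
      using assms uv norm_triangle_ineq[of "u *\<^sub>R x" "v *\<^sub>R y"]
      by (intro diff_left_mono mult_left_mono) auto
    finally show "l \<le> f (u *\<^sub>R x + v *\<^sub>R y) - a * norm (u *\<^sub>R x + v *\<^sub>R y)" .
  qed
qed

text \<open>Separation of the two hulls of unit vectors, rewritten by homogeneity as bounds on
  \<open>C\<close> and on the boundary of the cone.\<close>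

lemma ssp_cone_gen_functional:
  fixes C K :: "'a::real_normed_vector set"
  assumes ssp: "ssp (cone_gen C) (cone_gen K)" and y0: "y0 \<in> C" "y0 \<noteq> 0"
  obtains f :: "'a \<Rightarrow>\<^sub>L real" and \<beta> \<delta> where "norm f = 1" "\<beta> \<ge> 0" "\<delta> > 0"
    "\<And>y. y \<in> C \<Longrightarrow> (\<beta> + \<delta>) * norm y \<le> f y"
    "\<And>y. y \<in> frontier (cone_gen K) \<Longrightarrow> f y \<le> \<beta> * norm y"
proof -
  define A where "A = convex hull (cone_gen C \<inter> sphere 0 1)"
  define B where "B = convex hull ((frontier (cone_gen K) \<inter> sphere 0 1) \<union> {0})"
  define D where "D = {x - y | x y. x \<in> A \<and> y \<in> B}"
  have unit: "inverse (norm y) *\<^sub>R y \<in> A" if "y \<in> C" "y \<noteq> 0" for y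
    unfolding A_def using that by (intro hull_inc) (auto intro: cone_gen_scaleR)
  have "0 \<in> B" unfolding B_def by (rule hull_inc) simp
  have "D = (\<Union>x\<in>A. \<Union>y\<in>B. {x - y})" by (auto simp: D_def)
  then have "convex D" using convex_differences[of A B] by (simp add: A_def B_def)
  moreover have "D \<noteq> {}" using unit[OF y0] \<open>0 \<in> B\<close> by (auto simp: D_def)
  moreover have "0 \<notin> closure D" using ssp by (simp add: ssp_def D_def A_def B_def)
  ultimately obtain f :: "'a \<Rightarrow>\<^sub>L real" and \<delta> where
    f: "norm f = 1" "\<delta> > 0" "\<And>x. x \<in> D \<Longrightarrow> \<delta> \<le> f x"
    using strict_separation_zero_convex by blast
  have AB: "f y \<le> f x - \<delta>" if "x \<in> A" "y \<in> B" for x y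
  proof -
    have "x - y \<in> D" using that by (auto simp: D_def)
    then show ?thesis using f(3)[of "x - y"] by (simp add: blinfun.diff_right)
  qed
  \<comment> \<open>The supremum is finite because any value of \<open>f\<close> on \<open>A\<close>
    bounds it, and nonnegative because \<open>B\<close> contains 0.\<close>
  define \<beta> where "\<beta> = (SUP y\<in>B. f y)"
  have le: "f y \<le> \<beta>" if "y \<in> B" for y
    unfolding \<beta>_def using AB[OF unit[OF y0]] that by (intro cSUP_upper bdd_aboveI) auto
  have ge: "\<beta> + \<delta> \<le> f x" if "x \<in> A" for x
  proof -
    have "\<beta> \<le> f x - \<delta>"
      unfolding \<beta>_def using AB[OF that] \<open>0 \<in> B\<close> by (intro cSUP_least) auto
    then show ?thesis by simp
  qed
  show thesis
  proof
    show "norm f = 1" "\<delta> > 0" by fact+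
    show "\<beta> \<ge> 0" using le[OF \<open>0 \<in> B\<close>] by simp
    show "(\<beta> + \<delta>) * norm y \<le> f y" if "y \<in> C" for y
    proof (cases "y = 0")
      case False
      then show ?thesis using ge[OF unit[OF that False]]
        by (simp add: blinfun.scaleR_right field_simps)
    qed simp
    show "f y \<le> \<beta> * norm y" if "y \<in> frontier (cone_gen K)" for y
    proof (cases "y = 0")
      case False
      then have "inverse (norm y) *\<^sub>R y \<in> B"
        unfolding B_def using that by (intro hull_inc) (auto intro: frontier_cone_gen_scaleR)
      then show ?thesis using le[of "inverse (norm y) *\<^sub>R y"] False
        by (simp add: blinfun.scaleR_right field_simps)
    qed simp
  qed
qed

section \<open>From the strict separation property to conical separation\<close>

lemma ssp_imp_conically_separated:
  fixes C K :: "'a::real_normed_vector set"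
  assumes C: "C \<noteq> {}" "dist_zero C > 0"
    and K: "co_radiant K" "dist_zero K > 0" "admits_norm_base K"
    and ssp: "ssp (cone_gen C) (cone_gen K)"
  shows "conically_separated C K"
proof -
  obtain y0 where y0: "y0 \<in> C" "y0 \<noteq> 0"
    using C dist_zero_le[of _ C] by (metis all_not_in_conv norm_zero not_le)
  obtain f :: "'a \<Rightarrow>\<^sub>L real" and \<beta> \<delta> where f: "norm f = 1" "\<beta> \<ge> 0" "\<delta> > 0"
    and fC: "\<And>y. y \<in> C \<Longrightarrow> (\<beta> + \<delta>) * norm y \<le> f y"
    and fK: "\<And>y. y \<in> frontier (cone_gen K) \<Longrightarrow> f y \<le> \<beta> * norm y"
    using ssp_cone_gen_functional[OF ssp y0] by metis
  \<comment> \<open>Cutting the gap into thirds leaves \<open>a1\<close> above \<beta> and a margin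
    of \<delta>/3 above \<open>a2\<close>, which \<open>dist_zero C\<close> turns into a positive
    lower bound for \<open>l\<close>.\<close>
  define a1 a2 where "a1 = \<beta> + \<delta> / 3" and "a2 = \<beta> + 2 * \<delta> / 3"
  have a: "0 < a1" "a1 < a2" using f by (auto simp: a1_def a2_def)
  define M l where "M = margin_values C f a1 a2" and "l = Inf M"
  have "\<delta> / 3 * dist_zero C \<le> m" if "m \<in> M" for m
  proof -
    obtain y b where yb: "y \<in> C" "b < a2" "m = f y - b * norm y"
      using \<open>m \<in> M\<close> by (auto simp: M_def margin_values_def)
    have "\<delta> / 3 * dist_zero C \<le> \<delta> / 3 * norm y"
      using dist_zero_le[OF yb(1)] f(3) by (intro mult_left_mono) auto
    also have "\<dots> = (\<beta> + \<delta>) * norm y - a2 * norm y" by (simp add: a2_def algebra_simps)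
    also have "\<dots> \<le> f y - b * norm y"
      using fC[OF yb(1)] yb(2) by (intro diff_mono mult_right_mono) auto
    finally show ?thesis using yb(3) by simp
  qed
  note M_ge = this
  have "M \<noteq> {}"
    using y0(1) a(2) dense[of a1 a2] by (auto simp: M_def margin_values_def)
  then have "\<delta> / 3 * dist_zero C \<le> l" unfolding l_def using M_ge by (rule cInf_greatest)
  moreover have bdd: "bdd_below M" using M_ge by (rule bdd_belowI)
  moreover have "\<delta> / 3 * dist_zero C > 0" using f(3) C(2) by simp
  ultimately have "l > 0" by linarith
  have I: "inf_radius K > 0"
    using dist_zero_le_inf_radius[OF _ K(3)] K(1,2) by (force simp: co_radiant_def)
  \<comment> \<open>The bound at \<open>a2\<close> passes to the closed convex hull only as a weak
    inequality. It becomes strict for \<open>b < a2\<close> because \<open>l > 0\<close> excludes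
    \<open>y = 0\<close>.\<close>
  have lower: "l < f y - b * norm y" if "y \<in> closure (convex hull C)" "b < a2" for y b
  proof -
    have "C \<subseteq> {y. l \<le> f y - a2 * norm y}"
      using Inf_margin_values_le[OF bdd[unfolded M_def] a(2)] by (auto simp: l_def M_def)
    then have "closure (convex hull C) \<subseteq> {y. l \<le> f y - a2 * norm y}"
      using a by (intro closure_minimal hull_minimal closed_convex_superlevel) auto
    then have y: "l \<le> f y - a2 * norm y" using that(1) by blast
    then have "y \<noteq> 0" using \<open>l > 0\<close> by auto
    then have "b * norm y < a2 * norm y" using that(2) by simp
    then show ?thesis using y by simp
  qed
  have upper: "f y' - b * norm y' < l"
    if \<eta>: "0 < \<eta>" "\<eta> < l / inf_radius K" and b: "a1 < b" and y': "y' \<in> frontier (scaled K \<eta>)"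
    for \<eta> b y'
  proof -
    obtain w where w: "w \<in> frontier K" "y' = \<eta> *\<^sub>R w"
      using y' frontier_scaled[OF \<eta>(1), of K] by (auto simp: scaled_def)
    \<comment> \<open>Dividing by \<eta> moves the claim to the boundary of \<open>K\<close>
      itself.\<close>
    have "f w - b * norm w < l / \<eta>"
    proof (cases "w \<in> frontier (cone_gen K)")
      case True
      have "\<beta> * norm w \<le> b * norm w" using b f(3) by (intro mult_right_mono) (auto simp: a1_def)
      then have "f w - b * norm w \<le> 0" using fK[OF True] by simp
      also have "0 < l / \<eta>" using \<open>l > 0\<close> \<eta>(1) by simp
      finally show ?thesis .
    next
      case False
      \<comment> \<open>Off the boundary of the cone, only \<open>norm f = 1\<close> and the norm
        bound on \<open>w\<close> are available; the upper limit on \<eta> is what makes them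
        enough.\<close>
      have "f w \<le> norm w" using norm_blinfun[of f w] f(1) by simp
      moreover have "0 \<le> b * norm w" using b a(1) by simp
      ultimately have "f w - b * norm w \<le> inf_radius K"
        using norm_le_inf_radius[OF K(1,3) w(1) False] by simp
      also have "\<dots> < l / \<eta>" using \<eta> I by (simp add: field_simps)
      finally show ?thesis .
    qed
    then show ?thesis using \<eta>(1) w(2) by (simp add: blinfun.scaleR_right field_simps)
  qed
  show ?thesis
    unfolding conically_separated_def Let_def M_def[symmetric]
    using a f(1) bdd \<open>l > 0\<close> lower upper
    by (intro exI[of _ a1] exI[of _ a2] exI[of _ f]) (auto simp: l_def M_def)
qed

section \<open>From conical separation to the strict separation property\<close>

lemma conically_separated_imp_ssp:
  fixes C K :: "'a::real_normed_vector set"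
  assumes K: "co_radiant K" "dist_zero K > 0" "admits_norm_base K"
    and sep: "conically_separated C K"
  shows "ssp (cone_gen C) (cone_gen K)"
proof -
  obtain a1 a2 l and f :: "'a \<Rightarrow>\<^sub>L real" where a: "0 < a1" "a1 < a2"
    and l: "l = Inf (margin_values C f a1 a2)" "bdd_below (margin_values C f a1 a2)" "l > 0"
    and upper: "\<And>\<eta> b y' y. 0 < \<eta> \<Longrightarrow> \<eta> < l / inf_radius K \<Longrightarrow> a1 < b \<Longrightarrow> b < a2 \<Longrightarrow>
      y' \<in> frontier (scaled K \<eta>) \<Longrightarrow> y \<in> closure (convex hull C) \<Longrightarrow> f y' - b * norm y' < l"
    using sep unfolding conically_separated_def Let_def by (metis greaterThanLessThan_iff)
  have I: "inf_radius K > 0"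
    using dist_zero_le_inf_radius[OF _ K(3)] K(1,2) by (force simp: co_radiant_def)
  obtain t where t: "norm_base K t" "t > 0" using K(3) by (auto simp: admits_norm_base_def)
  obtain \<eta> where \<eta>: "0 < \<eta>" "\<eta> < l / inf_radius K"
    using dense[OF divide_pos_pos[OF l(3) I]] by blast
  \<comment> \<open>Since \<open>l > 0\<close>, the bound at \<open>a2\<close> weakens to a
    homogeneous inequality on \<open>C\<close>, which extends to the generated cone.\<close>
  have fC: "a2 \<le> f u" if u: "u \<in> cone_gen C \<inter> sphere 0 1" for u
  proof -
    obtain c y where y: "u = c *\<^sub>R y" "c \<ge> 0" "y \<in> C" using u by (auto simp: cone_gen_def)
    have "a2 * norm y \<le> f y" using Inf_margin_values_le[OF l(2) a(2) y(3)] l(1,3) by simp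
    then have "c * (a2 * norm y) \<le> c * f y" using y(2) by (intro mult_left_mono)
    moreover have "c * norm y = 1" using u y by simp
    ultimately show ?thesis using y(1) by (simp add: blinfun.scaleR_right mult.left_commute)
  qed
  \<comment> \<open>Nonemptiness of \<open>C\<close> supplies the point \<open>y\<close> over which
    the upper inequality is quantified. It suffices to bound \<open>f u\<close> by every
    \<open>b\<close> between \<open>a1\<close> and \<open>a2\<close>.\<close>
  have fK: "f u \<le> a1" if C: "C \<noteq> {}" and u: "u \<in> frontier (cone_gen K) \<inter> sphere 0 1" for u
  proof (rule dense_ge_bounded[OF a(2)])
    fix b assume b: "a1 < b" "b < a2"
    obtain y where y: "y \<in> closure (convex hull C)"
      using C closure_subset[of "convex hull C"] hull_subset[of C convex] by blast
    have bound: "c * (\<eta> * (f u - b)) < l" if "c > t" for c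
    proof -
      have "c *\<^sub>R u \<in> frontier K"
        using u that t frontier_norm_base_iff[OF K(1) t, of "c *\<^sub>R u"]
        by (auto intro: frontier_cone_gen_scaleR)
      then have "\<eta> *\<^sub>R c *\<^sub>R u \<in> scaled (frontier K) \<eta>"
        unfolding scaled_def by (rule imageI)
      then have "\<eta> *\<^sub>R c *\<^sub>R u \<in> frontier (scaled K \<eta>)"
        by (simp only: frontier_scaled[OF \<eta>(1)])
      from upper[OF \<eta> b this y] show ?thesis
        using u \<eta>(1) that t(2) by (simp add: blinfun.scaleR_right algebra_simps)
    qed
    show "f u \<le> b"
    proof (rule ccontr)
      assume "\<not> f u \<le> b"
      then have pos: "\<eta> * (f u - b) > 0" using \<eta>(1) by simp
      \<comment> \<open>This \<open>c\<close> exceeds \<open>t\<close>, so the bound applies, yet is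
        large enough for the product to reach \<open>l\<close>.\<close>
      define c where "c = max (t + 1) (l / (\<eta> * (f u - b)))"
      have "c * (\<eta> * (f u - b)) < l" by (rule bound) (simp add: c_def)
      moreover have "l / (\<eta> * (f u - b)) \<le> c" by (simp add: c_def)
      ultimately show False using pos by (simp add: pos_divide_le_eq)
    qed
  qed
  define A where "A = convex hull (cone_gen C \<inter> sphere 0 1)"
  define B where "B = convex hull ((frontier (cone_gen K) \<inter> sphere 0 1) \<union> {0})"
  have "f z \<ge> a2 - a1" if "z \<in> {x - y | x y. x \<in> A \<and> y \<in> B}" for z
  proof -
    obtain x y where xy: "z = x - y" "x \<in> A" "y \<in> B" using \<open>z \<in> _\<close> by blast
    then have "C \<noteq> {}" by (auto simp: A_def cone_gen_def)
    \<comment> \<open>Both hulls lie in half-spaces of \<open>f\<close>; for the extra point 0 of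
      \<open>B\<close> this uses \<open>0 < a1\<close>. The gap \<open>a2 - a1\<close> survives the
      closure.\<close>
    have "A \<subseteq> {x. a2 \<le> f x - 0 * norm x}"
      unfolding A_def using fC by (intro hull_minimal closed_convex_superlevel) auto
    moreover have "B \<subseteq> {x. - a1 \<le> (- f) x - 0 * norm x}"
      unfolding B_def using fK[OF \<open>C \<noteq> {}\<close>] a(1)
      by (intro hull_minimal closed_convex_superlevel) (auto simp: blinfun.minus_left)
    ultimately show ?thesis
      using xy by (auto simp: blinfun.diff_right blinfun.minus_left dest!: subsetD)
  qed
  then have "closure {x - y | x y. x \<in> A \<and> y \<in> B} \<subseteq> {z. a2 - a1 \<le> f z}"
    by (intro closure_minimal closed_Collect_le continuous_intros) auto
  then have "0 \<notin> closure {x - y | x y. x \<in> A \<and> y \<in> B}" using a(2) by auto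
  then show ?thesis by (simp add: ssp_def A_def B_def)
qed

theorem theorem4p1:
  fixes C K :: "'a::real_normed_vector set"
  assumes "co_radiant C" and "co_radiant K"
    and "dist_zero C * dist_zero K > 0"
    and "admits_norm_base K"
  shows "(ssp (cone_gen C) (cone_gen K) \<longrightarrow> conically_separated C K) \<and>
         (admits_norm_base C \<longrightarrow>
            conically_separated C K \<longrightarrow> ssp (cone_gen C) (cone_gen K))"
proof -
  have ne: "C \<noteq> {}" "K \<noteq> {}" using assms(1,2) by (auto simp: co_radiant_def)
  then have "dist_zero C > 0" "dist_zero K > 0"
    using assms(3) dist_zero_nonneg[of C] dist_zero_nonneg[of K] by (auto simp: zero_less_mult_iff)
  then show ?thesis
    using ssp_imp_conically_separated conically_separated_imp_ssp ne assms by blast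
qed

end
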